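(* Let $K$ be a field, $S=K[x_1,\ldots,x_n]$, and let $I=\bigcap_{i=1}^s P_i$ be a reduced (i.e. irredundant) intersection of monomial prime ideals $P_1,\ldots,P_s$ of $S$. Assume that $P_i\not\subset \sum_{1\le j\le s,\ j\neq i} P_j$ for all $i\in\{1,\ldots,s\}$. Then $$\operatorname{sdepth}_S I\geq \operatorname{depth}_S I,$$ that is, Stanley's Conjecture holds for $I$.
   Context: A monomial prime ideal of $S=K[x_1,\ldots,x_n]$ is an ideal generated by a subset of the variables. The intersection $\bigcap_{i=1}^s P_i$ is reduced (irredundant) if no $P_i$ can be omitted without changing the intersection, i.e. $P_i\not\subset P_j$ for $i\ne j$. The empty sum of ideals is the zero ideal. For a nonzero monomial ideal $I\subset S$, a monomial $u\in I$ and a subset $Z\subset\{x_1,\ldots,x_n\}$, $uK[Z]$ denotes the $K$-linear subspace generated by all $uf$ with $f\in K[Z]$. A Stanley decomposition of $I$ is a presentation $\mathcal D:\ I=\bigoplus_{i=1}^r u_iK[Z_i]$ of $I$ as a finite direct sum of $K$-subspaces, with $u_i\in I$ monomials, $Z_i\subset\{x_1,\ldots,x_n\}$ and $u_iK[Z_i]\subset I$. Set $\operatorname{sdepth}(\mathcal D)=\min\{|Z_i|: i=1,\ldots,r\}$ and $\operatorname{sdepth}_S I=\max\{\operatorname{sdepth}(\mathcal D):\ \mathcal D \text{ a Stanley decomposition of } I\}$. Stanley's Conjecture for $I$ is the inequality $\operatorname{sdepth}_S I\ge \operatorname{depth}_S I$. Here $\operatorname{depth}_S$ of a finitely generated graded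 $S$-module is the depth with respect to the maximal ideal $(x_1,\ldots,x_n)$, and $\operatorname{depth}_S I$ is the depth of $I$ as an $S$-module. *)

theory Defs
  imports
    Complex_Main
    "HOL-Library.Poly_Mapping"
    "HOL-Library.Set_Algebras"
    "HOL-Library.Extended_Nat"
begin

text \<open>
  The ring $K[x_1,\ldots,x_n]$ is the monoid algebra over the exponent vectors
  \<^typ>\<open>'x \<Rightarrow>\<^sub>0 nat\<close>. The variables are indexed by a type \<open>'x\<close>, which is
  finite (with $n$ elements) wherever finiteness matters.
\<close>

type_synonym ('x, 'k) mpoly = "('x \<Rightarrow>\<^sub>0 nat) \<Rightarrow>\<^sub>0 'k"

definition monomial :: "('x \<Rightarrow>\<^sub>0 nat) \<Rightarrow> ('x, 'k::comm_ring_1) mpoly" where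
  "monomial u = Poly_Mapping.single u 1"

definition Var :: "'x \<Rightarrow> ('x, 'k::comm_ring_1) mpoly" where
  "Var x = monomial (Poly_Mapping.single x 1)"

definition kscale :: "'k::comm_ring_1 \<Rightarrow> ('x, 'k) mpoly \<Rightarrow> ('x, 'k) mpoly" where
  "kscale c f = Poly_Mapping.single 0 c * f"

text \<open>
  Ideals are the submodules of a commutative ring regarded as a module over itself. There is no
  global interpretation of \<^locale>\<open>module\<close> for multiplication, because the simplification
  rules of the locale would clash with those for rings.
\<close>

lemma module_mult: "module ((*) :: 'a::comm_ring_1 \<Rightarrow> 'a \<Rightarrow> 'a)"
  by unfold_locales (simp_all add: algebra_simps)

lemma module_kscale: "module (kscale :: 'k::comm_ring_1 \<Rightarrow> ('x, 'k) mpoly \<Rightarrow> _)"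
  by unfold_locales
    (simp_all add: kscale_def distrib_left distrib_right single_add mult_single
      flip: mult.assoc)

definition ideal_gen :: "'a::comm_ring_1 set \<Rightarrow> 'a set" where
  "ideal_gen B = module.span (*) B"

definition monomial_prime_ideal :: "('x, 'k::field) mpoly set \<Rightarrow> bool" where
  "monomial_prime_ideal P \<longleftrightarrow> (\<exists>A. P = ideal_gen (Var ` A))"

definition irredundant_intersection :: "'i set \<Rightarrow> ('i \<Rightarrow> 'a set) \<Rightarrow> bool" where
  "irredundant_intersection T P \<longleftrightarrow> (\<forall>i\<in>T. (\<Inter>j\<in>T - {i}. P j) \<noteq> (\<Inter>j\<in>T. P j))"


subsection \<open>Depth\<close>

text \<open>
  The submodule $(f_1,\ldots,f_k)M$ for a set $F = \{f_1,\ldots,f_k\}$ and a submodule \<open>M\<close> of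
  the ring.
\<close>

definition ideal_times :: "'a::comm_ring_1 set \<Rightarrow> 'a set \<Rightarrow> 'a set" where
  "ideal_times F M = ideal_gen {f * m |f m. f \<in> F \<and> m \<in> M}"

text \<open>
  Regular sequences on an ideal \<open>M\<close>, regarded as a module: each element of the list is a
  nonzerodivisor on the quotient of \<open>M\<close> by the submodule that its predecessors generate,
  and the last quotient is nonzero.
\<close>

definition regular_sequence :: "'a::comm_ring_1 set \<Rightarrow> 'a list \<Rightarrow> bool" where
  "regular_sequence M fs \<longleftrightarrow>
     (\<forall>i<length fs. \<forall>m\<in>M. fs ! i * m \<in> ideal_times (set (take i fs)) M
        \<longrightarrow> m \<in> ideal_times (set (take i fs)) M) \<and>
     ideal_times (set fs) M \<noteq> M"

definition max_ideal :: "('x, 'k::field) mpoly set" where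
  "max_ideal = ideal_gen (range Var)"

text \<open>
  The maximal length of a regular sequence in the ideal of all variables. The supremum is taken
  in \<^typ>\<open>enat\<close>, so that its meaning does not depend on the lengths being bounded.
\<close>

definition depth :: "('x::finite, 'k::field) mpoly set \<Rightarrow> enat" where
  "depth M = Sup {enat (length fs) |fs. set fs \<subseteq> max_ideal \<and> regular_sequence M fs}"


subsection \<open>Stanley depth\<close>

definition polys_in :: "'x set \<Rightarrow> ('x, 'k::field) mpoly set" where
  "polys_in Z = {f. \<forall>m\<in>Poly_Mapping.keys f. Poly_Mapping.keys m \<subseteq> Z}"

text \<open>The space $uK[Z]$, where \<open>u\<close> is given by its exponent vector.\<close>

definition stanley_space :: "('x \<Rightarrow>\<^sub>0 nat) \<Rightarrow> 'x set \<Rightarrow> ('x, 'k::field) mpoly set" where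
  "stanley_space u Z = module.span kscale ((\<lambda>f. monomial u * f) ` polys_in Z)"

text \<open>The sum of the sets \<open>V i\<close> below is the elementwise sum of \<^theory>\<open>HOL-Library.Set_Algebras\<close>.\<close>

definition is_direct_sum :: "'a::comm_monoid_add set \<Rightarrow> nat \<Rightarrow> (nat \<Rightarrow> 'a set) \<Rightarrow> bool" where
  "is_direct_sum W r V \<longleftrightarrow>
     W = (\<Sum>i<r. V i) \<and>
     (\<forall>v. (\<forall>i<r. v i \<in> V i) \<and> (\<Sum>i<r. v i) = 0 \<longrightarrow> (\<forall>i<r. v i = 0))"

definition stanley_decomposition ::
    "('x::finite, 'k::field) mpoly set \<Rightarrow> (('x \<Rightarrow>\<^sub>0 nat) \<times> 'x set) list \<Rightarrow> bool" where
  "stanley_decomposition I D \<longleftrightarrow>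
     (\<forall>(u, Z)\<in>set D. monomial u \<in> I \<and> stanley_space u Z \<subseteq> I) \<and>
     is_direct_sum I (length D) (\<lambda>i. stanley_space (fst (D ! i)) (snd (D ! i)))"

definition sdepth_decomposition :: "(('x::finite \<Rightarrow>\<^sub>0 nat) \<times> 'x set) list \<Rightarrow> nat" where
  "sdepth_decomposition D = Min {card Z |u Z. (u, Z) \<in> set D}"

text \<open>
  Meaningful for nonzero monomial ideals: these have Stanley decompositions, all of them are
  nonempty, and the values \<^term>\<open>sdepth_decomposition D\<close> are bounded by the number of variables.
\<close>

definition sdepth :: "('x::finite, 'k::field) mpoly set \<Rightarrow> nat" where
  "sdepth I = Max {sdepth_decomposition D |D. stanley_decomposition I D}"

end

theory Submission
  imports Defs
begin

text \<open>
  Let $P_i$ be generated by the variables in \<open>A i\<close>. That $P_i$ is not contained in the sum of the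
  other primes means that \<open>A i\<close> has a private variable $p_i$, one that lies in no other \<open>A j\<close>.
  Let $q$ be the number of variables outside all the \<open>A i\<close>, and put $t = q + s$. Then
  $\mathrm{depth}\, I \le t \le \mathrm{sdepth}\, I$.

  For the depth, consider the Koszul cohomology of $I$ with respect to the variables. A regular
  sequence of length $r$ in the maximal ideal makes it vanish in all degrees below $r$
  (\<open>koszul_cocycle_is_boundary\<close>), so a nonzero class in degree $t$ is enough. Divide the variables
  in the union of the \<open>A i\<close> into disjoint blocks $B_i$, where $B_i$ is contained in \<open>A i\<close> and
  contains $p_i$. In the exterior algebra, put $w_i = \sum_{x\in B_i} x\, e_x$ and let
  $\varepsilon$ be the product of the $e_x$ over the variables $x$ outside all the \<open>A i\<close>. Then
  $w_s\wedge\cdots\wedge w_1\wedge\varepsilon$ is a cocycle, because the Koszul differential is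
  the product with the sum of the $w_i$ and of terms that kill $\varepsilon$, while
  $w_i\wedge w_i = 0$. Its coefficients lie in $I$, and one of them is $\pm p_1\cdots p_s$. The
  coefficients of a coboundary lie in $(x_1,\ldots,x_n)I$, which does not contain
  $p_1\cdots p_s$, because no $p_i$ can be cancelled from this monomial within $I$
  (\<open>private_monomial_not_in_max_ideal_times\<close>).

  For the Stanley depth, sort the monomials of $I$ by the set $\tau$ of those variables in their
  support that lie in some \<open>A i\<close> but are not among the $p_i$. For a given $\tau$, a monomial
  belongs to $I$ if and only if its support contains the $p_i$ of all \<open>A i\<close> that $\tau$ misses. So
  the monomials of $I$ with the same $\tau$ span a single Stanley space, whose set of free variables
  consists of $\tau$, of $p_1,\ldots,p_s$ and of the $q$ variables outside all the \<open>A i\<close>. Its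
  size is at least $t$ (\<open>in_interval_iff\<close>, \<open>sdepth_ge\<close>).
\<close>


section \<open>The Koszul complex of a finite family of ring elements\<close>

abbreviation ideal :: "'a::comm_ring_1 set \<Rightarrow> bool" where
  "ideal \<equiv> module.subspace (*)"

lemmas idealI = module.subspaceI[OF module_mult]
  and ideal_zero = module.subspace_0[OF module_mult]
  and ideal_add = module.subspace_add[OF module_mult]
  and ideal_diff = module.subspace_diff[OF module_mult]
  and ideal_mult = module.subspace_scale[OF module_mult]
  and ideal_sum = module.subspace_sum[OF module_mult]

lemma ideal_ideal_gen: "ideal (ideal_gen B)"
  unfolding ideal_gen_def by (rule module.subspace_span[OF module_mult])

lemma ideal_gen_base: "b \<in> B \<Longrightarrow> b \<in> ideal_gen B"
  unfolding ideal_gen_def by (rule module.span_base[OF module_mult])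

lemma ideal_gen_minimal: "B \<subseteq> J \<Longrightarrow> ideal J \<Longrightarrow> ideal_gen B \<subseteq> J"
  unfolding ideal_gen_def by (rule module.span_minimal[OF module_mult])

text \<open>
  The sign that appears when $e_k$ moves past $e_l$. The order of the indices is immaterial, so
  an arbitrary enumeration of the finite index type serves.
\<close>

definition swap_sign :: "'x::finite \<Rightarrow> 'x \<Rightarrow> 'a::comm_ring_1" where
  "swap_sign k l = (if to_nat l < to_nat k then - 1 else 1)"

definition koszul_sign :: "'x::finite \<Rightarrow> 'x set \<Rightarrow> 'a::comm_ring_1" where
  "koszul_sign k \<sigma> = (\<Prod>l\<in>\<sigma>. swap_sign k l)"

text \<open>
  A function \<open>c\<close> on sets of indices stands for the element $\sum_\sigma c(\sigma)\,e_\sigma$ of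
  the exterior algebra on generators $e_k$. The differential is left multiplication by
  $\sum_k a_k e_k$, and the sign is the one in $e_k\wedge e_{\sigma\setminus\{k\}} = \pm e_\sigma$.
\<close>

definition koszul_d :: "('x::finite \<Rightarrow> 'a::comm_ring_1) \<Rightarrow> ('x set \<Rightarrow> 'a) \<Rightarrow> 'x set \<Rightarrow> 'a" where
  "koszul_d a c \<sigma> = (\<Sum>k\<in>\<sigma>. koszul_sign k \<sigma> * a k * c (\<sigma> - {k}))"

text \<open>
  The interior product with the linear form $e_k\mapsto b_k$.
\<close>

definition contraction :: "('x::finite \<Rightarrow> 'a::comm_ring_1) \<Rightarrow> ('x set \<Rightarrow> 'a) \<Rightarrow> 'x set \<Rightarrow> 'a" where
  "contraction b c \<sigma> = (\<Sum>l\<in>- \<sigma>. b l * koszul_sign l \<sigma> * c (insert l \<sigma>))"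

lemma swap_sign_self [simp]: "swap_sign k k = 1"
  by (simp add: swap_sign_def)

lemma swap_sign_swap: "k \<noteq> l \<Longrightarrow> swap_sign k l * swap_sign l k = (- 1 :: 'a::comm_ring_1)"
  using inj_to_nat[THEN injD, of k l] by (auto simp: swap_sign_def)

lemma koszul_sign_insert:
  "l \<notin> \<sigma> \<Longrightarrow> koszul_sign k (insert l \<sigma>) =
    (swap_sign k l * koszul_sign k \<sigma> :: 'a::comm_ring_1)"
  by (simp add: koszul_sign_def)

lemma koszul_sign_cases: "koszul_sign k \<sigma> = (1::'a::comm_ring_1) \<or> koszul_sign k \<sigma> = (- 1 :: 'a)"
  unfolding koszul_sign_def using finite[of \<sigma>]
  by (induction \<sigma> rule: finite_induct) (auto simp: swap_sign_def)

lemma koszul_sign_square: "koszul_sign k \<sigma> * koszul_sign k \<sigma> = (1::'a::comm_ring_1)"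
  using koszul_sign_cases[of k \<sigma>, where 'a = 'a] by auto

lemma koszul_sign_exchange:
  assumes "k \<noteq> l" "k \<notin> \<sigma>" "l \<notin> \<sigma>"
  shows "koszul_sign k (insert l \<sigma>) * koszul_sign l \<sigma> =
    - (koszul_sign l (insert k \<sigma>) * koszul_sign k \<sigma> :: 'a::comm_ring_1)"
proof -
  have "swap_sign k l = - (swap_sign l k :: 'a)"
    using swap_sign_swap[OF assms(1), where 'a = 'a] by (auto simp: swap_sign_def split: if_splits)
  then show ?thesis
    using assms by (simp add: koszul_sign_insert)
qed

text \<open>
  Each term is cancelled by its mirror image. An argument that the sum equals its own negative
  would miss characteristic 2.
\<close>

lemma sum_antisymmetric_pairs:
  fixes F :: "'x \<Rightarrow> 'x \<Rightarrow> 'a::ab_group_add"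
  assumes "finite \<sigma>" "\<And>k l. k \<in> \<sigma> \<Longrightarrow> l \<in> \<sigma> \<Longrightarrow> k \<noteq> l \<Longrightarrow> F k l = - F l k"
  shows "(\<Sum>k\<in>\<sigma>. \<Sum>l\<in>\<sigma> - {k}. F k l) = 0"
  using assms
proof (induction \<sigma> rule: finite_induct)
  case (insert x \<sigma>)
  have "(\<Sum>l\<in>insert x \<sigma> - {k}. F k l) = F k x + (\<Sum>l\<in>\<sigma> - {k}. F k l)" if "k \<in> \<sigma>" for k
  proof -
    have "insert x \<sigma> - {k} = insert x (\<sigma> - {k})"
      using that insert.hyps by auto
    then show ?thesis
      using insert.hyps by simp
  qed
  then have "(\<Sum>k\<in>insert x \<sigma>. \<Sum>l\<in>insert x \<sigma> - {k}. F k l) =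
      (\<Sum>l\<in>\<sigma>. F x l) + ((\<Sum>k\<in>\<sigma>. F k x) + (\<Sum>k\<in>\<sigma>. \<Sum>l\<in>\<sigma> - {k}. F k l))"
    using insert.hyps by (simp add: sum.distrib)
  also have "(\<Sum>k\<in>\<sigma>. \<Sum>l\<in>\<sigma> - {k}. F k l) = 0"
    by (rule insert.IH) (rule insert.prems; simp)
  also have "(\<Sum>l\<in>\<sigma>. F x l) = (\<Sum>k\<in>\<sigma>. - F k x)"
  proof (rule sum.cong)
    show "F x l = - F l x" if "l \<in> \<sigma>" for l
      by (rule insert.prems) (use that insert.hyps in auto)
  qed simp
  finally show ?case
    by (simp add: sum_negf)
qed simp

lemma koszul_d_add: "koszul_d a (\<lambda>\<tau>. c \<tau> + c' \<tau>) \<sigma> = koszul_d a c \<sigma> + koszul_d a c' \<sigma>"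
  by (simp add: koszul_d_def distrib_left sum.distrib)

lemma koszul_d_diff: "koszul_d a (\<lambda>\<tau>. c \<tau> - c' \<tau>) \<sigma> = koszul_d a c \<sigma> - koszul_d a c' \<sigma>"
  by (simp add: koszul_d_def right_diff_distrib sum_subtractf)

lemma koszul_d_smult: "koszul_d a (\<lambda>\<tau>. r * c \<tau>) \<sigma> = r * koszul_d a c \<sigma>"
  by (simp add: koszul_d_def sum_distrib_left mult_ac)

lemma koszul_d_add_weight: "koszul_d (\<lambda>k. a k + b k) c \<sigma> = koszul_d a c \<sigma> + koszul_d b c \<sigma>"
  by (simp add: koszul_d_def distrib_left distrib_right sum.distrib)

lemma koszul_d_sum_weight:
  "koszul_d (\<lambda>k. \<Sum>i\<in>T. a i k) c \<sigma> = (\<Sum>i\<in>T. koszul_d (a i) c \<sigma>)"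
proof -
  have "koszul_d (\<lambda>k. \<Sum>i\<in>T. a i k) c \<sigma> =
      (\<Sum>k\<in>\<sigma>. \<Sum>i\<in>T. koszul_sign k \<sigma> * a i k * c (\<sigma> - {k}))"
    by (simp add: koszul_d_def sum_distrib_left sum_distrib_right)
  also have "\<dots> = (\<Sum>i\<in>T. koszul_d (a i) c \<sigma>)"
    unfolding koszul_d_def by (rule sum.swap)
  finally show ?thesis .
qed

lemma koszul_d_in:
  assumes "ideal J" "\<And>\<tau>. c \<tau> \<in> J"
  shows "koszul_d a c \<sigma> \<in> J"
  unfolding koszul_d_def using assms by (intro ideal_sum ideal_mult)

lemma contraction_in:
  assumes "ideal J" "\<And>\<tau>. c \<tau> \<in> J"
  shows "contraction b c \<sigma> \<in> J"
  unfolding contraction_def using assms by (intro ideal_sum ideal_mult)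

text \<open>
  The terms of the double sum are indexed by the ordered pairs of indices that are removed
  from \<open>\<sigma>\<close>; exchanging the two indices changes only the sign.
\<close>

lemma koszul_d_square:
  fixes a :: "'x::finite \<Rightarrow> 'a::comm_ring_1"
  shows "koszul_d a (koszul_d a c) \<sigma> = 0"
proof -
  define F where "F k l = koszul_sign k \<sigma> * a k * (koszul_sign l (\<sigma> - {k}) * a l * c (\<sigma> - {k} - {l}))"
    for k l
  have "F k l = - F l k" if "k \<in> \<sigma>" "l \<in> \<sigma>" "k \<noteq> l" for k l
  proof -
    define \<rho> where "\<rho> = \<sigma> - {k} - {l}"
    have eqs: "\<sigma> - {k} = insert l \<rho>" "\<sigma> - {l} = insert k \<rho>" "\<sigma> = insert k (insert l \<rho>)"
      "k \<notin> \<rho>" "l \<notin> \<rho>" "insert l \<rho> - {l} = \<rho>" "insert k \<rho> - {k} = \<rho>"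
      using that by (auto simp: \<rho>_def)
    have 1: "koszul_sign k \<sigma> = (koszul_sign k (insert l \<rho>) :: 'a)"
      using eqs that by (simp add: koszul_sign_insert)
    have 2: "koszul_sign l \<sigma> = (koszul_sign l (insert k \<rho>) :: 'a)"
      using eqs that by (simp add: koszul_sign_insert insert_commute[of k l])
    have sgn: "koszul_sign k \<sigma> * koszul_sign l (\<sigma> - {k}) =
        - (koszul_sign l \<sigma> * koszul_sign k (\<sigma> - {l}) :: 'a)"
      unfolding 1 2 eqs(1,2) using koszul_sign_exchange[OF that(3) eqs(4,5), where 'a = 'a]
      by (simp add: koszul_sign_insert eqs)
    have "F k l = (koszul_sign k \<sigma> * koszul_sign l (\<sigma> - {k})) * (a k * a l * c \<rho>)"
      by (simp add: F_def \<rho>_def mult_ac)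
    also have "\<dots> = - ((koszul_sign l \<sigma> * koszul_sign k (\<sigma> - {l})) * (a k * a l * c \<rho>))"
      by (simp add: sgn)
    also have "\<dots> = - F l k"
      unfolding F_def eqs(2,7) by (simp add: mult_ac)
    finally show ?thesis .
  qed
  then have "(\<Sum>k\<in>\<sigma>. \<Sum>l\<in>\<sigma> - {k}. F k l) = 0"
    by (rule sum_antisymmetric_pairs[OF finite])
  then show ?thesis
    by (simp add: koszul_d_def F_def sum_distrib_left)
qed

text \<open>
  Polarization: the differential of the weight \<open>a + b\<close> also squares to zero.
\<close>

lemma koszul_d_anticommute:
  fixes a :: "'x::finite \<Rightarrow> 'a::comm_ring_1"
  shows "koszul_d a (koszul_d b c) \<sigma> = - koszul_d b (koszul_d a c) \<sigma>"
proof -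
  let ?ab = "\<lambda>k. a k + b k"
  have "koszul_d ?ab c = (\<lambda>\<tau>. koszul_d a c \<tau> + koszul_d b c \<tau>)"
    by (simp add: fun_eq_iff koszul_d_add_weight)
  then have "koszul_d ?ab (koszul_d ?ab c) \<sigma> =
      koszul_d a (koszul_d b c) \<sigma> + koszul_d b (koszul_d a c) \<sigma>"
    by (simp add: koszul_d_add_weight koszul_d_add koszul_d_square add.commute)
  then show ?thesis
    by (simp add: koszul_d_square eq_neg_iff_add_eq_0)
qed

text \<open>
  The interior product is an antiderivation of the exterior algebra. In coordinates, the terms
  that return to \<open>\<sigma>\<close> give the right-hand side, and the others cancel in pairs, one from each of
  the two summands.

  It follows that every element of the ideal generated by the \<open>a k\<close> acts on the Koszul complex by
  a map that is homotopic to zero.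
\<close>

lemma contraction_homotopy:
  fixes a :: "'x::finite \<Rightarrow> 'a::comm_ring_1"
  shows "koszul_d a (contraction b c) \<sigma> + contraction b (koszul_d a c) \<sigma> = (\<Sum>k\<in>UNIV. b k * a k) * c \<sigma>"
proof -
  \<comment> \<open>Remove \<open>k\<close> from \<open>\<sigma>\<close> and add \<open>l\<close>; the terms with \<open>k = l\<close> are those that return to \<open>\<sigma>\<close>.\<close>
  define T where "T k l = koszul_sign k \<sigma> * a k * (b l * koszul_sign l (\<sigma> - {k}) * c (insert l (\<sigma> - {k})))"
    for k l
  have "koszul_d a (contraction b c) \<sigma> = (\<Sum>k\<in>\<sigma>. \<Sum>l\<in>insert k (- \<sigma>). T k l)"
    unfolding koszul_d_def contraction_def T_def sum_distrib_left
    by (intro sum.cong) auto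
  also have "\<dots> = (\<Sum>k\<in>\<sigma>. T k k) + (\<Sum>k\<in>\<sigma>. \<Sum>l\<in>- \<sigma>. T k l)"
    by (simp add: sum.distrib)
  also have "(\<Sum>k\<in>\<sigma>. T k k) = (\<Sum>k\<in>\<sigma>. b k * a k * c \<sigma>)"
  proof (rule sum.cong)
    fix k assume k: "k \<in> \<sigma>"
    have "koszul_sign k \<sigma> = (koszul_sign k (\<sigma> - {k}) :: 'a)"
      using koszul_sign_insert[of k "\<sigma> - {k}" k, where 'a = 'a] k by (simp add: insert_absorb)
    then have "T k k = (koszul_sign k \<sigma> * koszul_sign k \<sigma>) * (b k * a k * c \<sigma>)"
      using k by (simp add: T_def insert_absorb mult_ac)
    then show "T k k = b k * a k * c \<sigma>"
      by (simp add: koszul_sign_square)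
  qed simp
  finally have 1: "koszul_d a (contraction b c) \<sigma> =
      (\<Sum>k\<in>\<sigma>. b k * a k * c \<sigma>) + (\<Sum>k\<in>\<sigma>. \<Sum>l\<in>- \<sigma>. T k l)" .
  have "contraction b (koszul_d a c) \<sigma> = (\<Sum>l\<in>- \<sigma>. b l * a l * c \<sigma> + (\<Sum>k\<in>\<sigma>. - T k l))"
    unfolding contraction_def
  proof (rule sum.cong)
    fix l assume l: "l \<in> - \<sigma>"
    have "b l * koszul_sign l \<sigma> * (koszul_sign k (insert l \<sigma>) * a k * c (insert l \<sigma> - {k})) = - T k l"
      if k: "k \<in> \<sigma>" for k
    proof -
      define \<rho> where "\<rho> = \<sigma> - {k}"
      have eqs: "\<sigma> = insert k \<rho>" "k \<notin> \<rho>" "l \<notin> \<rho>" "k \<noteq> l" "insert l \<sigma> - {k} = insert l \<rho>"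
        using k l by (auto simp: \<rho>_def)
      have s1: "koszul_sign k \<sigma> = (koszul_sign k \<rho> :: 'a)"
        by (simp add: eqs koszul_sign_insert)
      have s2: "koszul_sign k (insert l \<sigma>) = (koszul_sign k (insert l \<rho>) :: 'a)"
        using l eqs(3) s1 by (simp add: koszul_sign_insert)
      have "koszul_sign l \<sigma> * koszul_sign k (insert l \<sigma>) = - (koszul_sign k \<sigma> * koszul_sign l \<rho> :: 'a)"
      proof -
        have "koszul_sign l \<sigma> * koszul_sign k (insert l \<sigma>) =
            (swap_sign l k * swap_sign k l) * (koszul_sign k \<rho> * koszul_sign l \<rho> :: 'a)"
          unfolding s2 using eqs by (simp add: koszul_sign_insert)
        then show ?thesis
          using swap_sign_swap[of l k, where 'a = 'a] eqs(4) s1 by simp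
      qed
      then have "(koszul_sign l \<sigma> * koszul_sign k (insert l \<sigma>)) * (a k * b l * c (insert l \<rho>)) = - T k l"
        by (simp add: T_def \<rho>_def mult_ac)
      then show ?thesis
        unfolding eqs(5) by (simp add: mult_ac)
    qed
    moreover have "b l * koszul_sign l \<sigma> * (koszul_sign l (insert l \<sigma>) * a l * c (insert l \<sigma> - {l})) =
        b l * a l * c \<sigma>"
    proof -
      have "b l * koszul_sign l \<sigma> * (koszul_sign l (insert l \<sigma>) * a l * c (insert l \<sigma> - {l})) =
        (koszul_sign l \<sigma> * koszul_sign l \<sigma>) * (b l * a l * c \<sigma>)"
        using l by (simp add: koszul_sign_insert mult_ac)
      then show ?thesis
        by (simp add: koszul_sign_square)
    qed
    ultimately show "b l * koszul_sign l \<sigma> * koszul_d a c (insert l \<sigma>) =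
        b l * a l * c \<sigma> + (\<Sum>k\<in>\<sigma>. - T k l)"
      using l by (simp add: koszul_d_def distrib_left sum_distrib_left)
  qed simp
  also have "\<dots> = (\<Sum>l\<in>- \<sigma>. b l * a l * c \<sigma>) - (\<Sum>k\<in>\<sigma>. \<Sum>l\<in>- \<sigma>. T k l)"
    using sum.swap[of "\<lambda>l k. T k l" \<sigma> "- \<sigma>"]
    by (simp add: sum_negf sum_subtractf)
  finally have 2: "contraction b (koszul_d a c) \<sigma> =
      (\<Sum>l\<in>- \<sigma>. b l * a l * c \<sigma>) - (\<Sum>k\<in>\<sigma>. \<Sum>l\<in>- \<sigma>. T k l)" .
  have "(\<Sum>k\<in>\<sigma>. b k * a k * c \<sigma>) + (\<Sum>l\<in>- \<sigma>. b l * a l * c \<sigma>) = (\<Sum>k\<in>\<sigma> \<union> - \<sigma>. b k * a k * c \<sigma>)"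
    by (rule sum.union_disjoint[symmetric]) auto
  then show ?thesis
    by (simp add: 1 2 sum_distrib_right Compl_partition)
qed


section \<open>Vanishing of Koszul cohomology below the length of a regular sequence\<close>

lemma ideal_gen_range_combination:
  assumes "f \<in> ideal_gen (range (a :: 'x::finite \<Rightarrow> 'a::comm_ring_1))"
  obtains b where "f = (\<Sum>k\<in>UNIV. b k * a k)"
proof -
  let ?J = "{f. \<exists>b. f = (\<Sum>k\<in>UNIV. b k * a k)}"
  have "ideal ?J"
  proof (rule idealI)
    show "0 \<in> ?J"
      by (auto intro!: exI[of _ "\<lambda>_. 0"])
    show "f + g \<in> ?J" if fg: "f \<in> ?J" "g \<in> ?J" for f g
    proof -
      obtain b b' where "f = (\<Sum>k\<in>UNIV. b k * a k)" "g = (\<Sum>k\<in>UNIV. b' k * a k)"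
        using fg by blast
      then have "f + g = (\<Sum>k\<in>UNIV. (b k + b' k) * a k)"
        by (simp add: distrib_right sum.distrib)
      then show ?thesis
        by auto
    qed
    show "r * f \<in> ?J" if f: "f \<in> ?J" for r f
    proof -
      obtain b where "f = (\<Sum>k\<in>UNIV. b k * a k)"
        using f by auto
      then have "r * f = (\<Sum>k\<in>UNIV. (r * b k) * a k)"
        by (simp add: sum_distrib_left mult_ac)
      then show ?thesis
        by (intro CollectI exI[of _ "\<lambda>k. r * b k"])
    qed
  qed
  moreover have "range a \<subseteq> ?J"
  proof safe
    fix x
    have "a x = (\<Sum>k\<in>UNIV. (if k = x then 1 else 0) * a k)"
      by (simp add: if_distribR if_distrib[of "\<lambda>u. u * _"] cong: if_cong)
    then show "\<exists>b. a x = (\<Sum>k\<in>UNIV. b k * a k)"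
      by (rule exI[of _ "\<lambda>k. if k = x then 1 else 0"])
  qed
  ultimately show ?thesis
    using ideal_gen_minimal[of "range a" ?J] assms that by blast
qed

lemma ideal_ideal_times: "ideal (ideal_times F M)"
  unfolding ideal_times_def by (rule ideal_ideal_gen)

lemma ideal_times_base: "f \<in> F \<Longrightarrow> m \<in> M \<Longrightarrow> f * m \<in> ideal_times F M"
  unfolding ideal_times_def by (rule ideal_gen_base) auto

lemma ideal_times_mono: "F \<subseteq> G \<Longrightarrow> ideal_times F M \<subseteq> ideal_times G M"
  unfolding ideal_times_def by (rule ideal_gen_minimal) (auto intro: ideal_gen_base ideal_ideal_gen)

lemma ideal_times_empty: "ideal_times {} M = {0}"
  using module.span_empty[OF module_mult] by (simp add: ideal_times_def ideal_gen_def)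

text \<open>
  Since \<open>M\<close> is closed under multiplication by the ring, a single multiple of \<open>f\<close> is enough.
\<close>

lemma ideal_times_insertE:
  assumes "ideal M" "g \<in> ideal_times (insert f F) M"
  obtains m n where "m \<in> M" "n \<in> ideal_times F M" "g = f * m + n"
proof -
  let ?J = "{f * m + n |m n. m \<in> M \<and> n \<in> ideal_times F M}"
  have "ideal ?J"
  proof (rule idealI)
    show "0 \<in> ?J"
      using ideal_zero[OF assms(1)] ideal_zero[OF ideal_ideal_times[of F M]] by force
    show "g + h \<in> ?J" if gh: "g \<in> ?J" "h \<in> ?J" for g h
    proof -
      obtain m n m' n' where mem: "m \<in> M" "n \<in> ideal_times F M" "m' \<in> M" "n' \<in> ideal_times F M"
        and "g = f * m + n" "h = f * m' + n'"
        using gh by blast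
      then have "g + h = f * (m + m') + (n + n')"
        by (simp add: algebra_simps)
      then show ?thesis
        using mem assms(1) ideal_ideal_times[of F M] by (auto intro!: ideal_add)
    qed
    show "r * g \<in> ?J" if g: "g \<in> ?J" for r g
    proof -
      obtain m n where mem: "m \<in> M" "n \<in> ideal_times F M" and "g = f * m + n"
        using g by blast
      then have "r * g = f * (r * m) + r * n"
        by (simp add: algebra_simps)
      then show ?thesis
        using mem assms(1) ideal_ideal_times[of F M] by (auto intro!: ideal_mult)
    qed
  qed
  moreover have "{g * m |g m. g \<in> insert f F \<and> m \<in> M} \<subseteq> ?J"
  proof safe
    fix g m assume m: "m \<in> M"
    show "\<exists>m' n. f * m = f * m' + n \<and> m' \<in> M \<and> n \<in> ideal_times F M"
      using m ideal_zero[OF ideal_ideal_times[of F M]] by (intro exI[of _ m] exI[of _ 0]) simp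
    assume g: "g \<in> F"
    show "\<exists>m' n. g * m = f * m' + n \<and> m' \<in> M \<and> n \<in> ideal_times F M"
      using ideal_times_base[OF g m] ideal_zero[OF assms(1)]
      by (intro exI[of _ 0] exI[of _ "g * m"]) simp
  qed
  ultimately have "ideal_times (insert f F) M \<subseteq> ?J"
    unfolding ideal_times_def[of "insert f F"] by (rule ideal_gen_minimal[rotated])
  then show ?thesis
    using assms(2) that by blast
qed

text \<open>
  The Koszul cohomology of $M/(f_1,\ldots,f_j)M$ vanishes in degrees below $r - j$, where $r$ is
  the length of the sequence. The degrees are not treated separately: a cochain that is supported
  on sets of fewer than $r - j$ elements is handled as a whole.

  The induction goes down from $j = r$, where only the zero cochain is left. For the step, let
  $f = f_{j+1}$. Multiplication by $f$ is homotopic to zero, so $fc$ is the boundary of a cochain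
  $g$ modulo $(f_1,\ldots,f_j)M$, and $g$ is a cocycle modulo $(f_1,\ldots,f_{j+1})M$, supported in
  lower degrees. By induction $g = de + fm$ modulo $(f_1,\ldots,f_j)M$, hence $fc = f\,dm$ modulo
  the same submodule, and $f$ can be cancelled by regularity.
\<close>

lemma koszul_cocycle_is_boundary_mod:
  fixes a :: "'x::finite \<Rightarrow> 'a::comm_ring_1"
  assumes M: "ideal M" and reg: "regular_sequence M fs" and fs: "set fs \<subseteq> ideal_gen (range a)"
    and "j \<le> length fs"
    and "\<And>\<sigma>. c \<sigma> \<in> M" "\<And>\<sigma>. length fs - j \<le> card \<sigma> \<Longrightarrow> c \<sigma> = 0"
    and "\<And>\<sigma>. koszul_d a c \<sigma> \<in> ideal_times (set (take j fs)) M"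
  shows "\<exists>e. (\<forall>\<sigma>. e \<sigma> \<in> M) \<and> (\<forall>\<sigma>. c \<sigma> - koszul_d a e \<sigma> \<in> ideal_times (set (take j fs)) M)"
  using assms(4-)
proof (induction j arbitrary: c rule: inc_induct)
  case base
  then have "c = (\<lambda>_. 0)"
    by auto
  then show ?case
    using ideal_zero[OF M] ideal_zero[OF ideal_ideal_times]
    by (intro exI[of _ "\<lambda>_. 0"]) (simp add: koszul_d_def)
next
  case (step j)
  define f where "f = fs ! j"
  define N where "N = ideal_times (set (take j fs)) M"
  define N' where "N' = ideal_times (set (take (Suc j) fs)) M"
  have take: "set (take (Suc j) fs) = insert f (set (take j fs))"
    using step.hyps by (simp add: take_Suc_conv_app_nth f_def)
  have N: "ideal N" and N': "ideal N'" and sub: "N \<subseteq> N'"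
    unfolding N_def N'_def take by (auto intro: ideal_ideal_times ideal_times_mono[THEN subsetD])
  have f_reg: "m \<in> N" if "m \<in> M" "f * m \<in> N" for m
    using reg step.hyps that unfolding regular_sequence_def N_def f_def by blast
  have "f \<in> ideal_gen (range a)"
    using fs step.hyps by (auto simp: f_def)
  then obtain b where b: "f = (\<Sum>k\<in>UNIV. b k * a k)"
    by (rule ideal_gen_range_combination)
  define g where "g = contraction b c"
  have gM: "g \<sigma> \<in> M" for \<sigma>
    unfolding g_def by (rule contraction_in[OF M step.prems(1)])
  have g_card: "g \<sigma> = 0" if "length fs - Suc j \<le> card \<sigma>" for \<sigma>
    using that step.prems(2) unfolding g_def contraction_def by (intro sum.neutral) auto
  have homotopy: "koszul_d a g \<sigma> = f * c \<sigma> - contraction b (koszul_d a c) \<sigma>" for \<sigma>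
    using contraction_homotopy[of a b c \<sigma>] by (simp add: b g_def algebra_simps)
  have hd_N: "contraction b (koszul_d a c) \<sigma> \<in> N" for \<sigma>
    using step.prems(3) by (intro contraction_in[OF N]) (simp add: N_def)
  have "koszul_d a g \<sigma> \<in> N'" for \<sigma>
  proof -
    have "f * c \<sigma> \<in> N'"
      unfolding N'_def take using step.prems(1) by (intro ideal_times_base) auto
    then show ?thesis
      unfolding homotopy using hd_N sub by (intro ideal_diff[OF N']) auto
  qed
  then obtain e where eM: "\<And>\<sigma>. e \<sigma> \<in> M" and "\<And>\<sigma>. g \<sigma> - koszul_d a e \<sigma> \<in> N'"
    using step.IH[of g] gM g_card unfolding N'_def by blast
  then have "\<exists>m n. m \<in> M \<and> n \<in> N \<and> g \<sigma> - koszul_d a e \<sigma> = f * m + n" for \<sigma>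
    unfolding N'_def N_def take by (meson M ideal_times_insertE)
  then obtain m n where mM: "\<And>\<sigma>. m \<sigma> \<in> M" and nN: "\<And>\<sigma>. n \<sigma> \<in> N"
    and g_eq: "\<And>\<sigma>. g \<sigma> - koszul_d a e \<sigma> = f * m \<sigma> + n \<sigma>"
    by metis
  have "c \<sigma> - koszul_d a m \<sigma> \<in> N" for \<sigma>
  proof (rule f_reg)
    show "c \<sigma> - koszul_d a m \<sigma> \<in> M"
      by (intro ideal_diff[OF M] koszul_d_in[OF M] step.prems(1) mM)
    have "koszul_d a (\<lambda>\<tau>. g \<tau> - koszul_d a e \<tau>) \<sigma> = koszul_d a g \<sigma>"
      by (simp add: koszul_d_diff koszul_d_square)
    then have "koszul_d a g \<sigma> = f * koszul_d a m \<sigma> + koszul_d a n \<sigma>"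
      by (simp add: g_eq koszul_d_add koszul_d_smult)
    then have "f * (c \<sigma> - koszul_d a m \<sigma>) = koszul_d a n \<sigma> + contraction b (koszul_d a c) \<sigma>"
      by (simp add: homotopy algebra_simps)
    then show "f * (c \<sigma> - koszul_d a m \<sigma>) \<in> N"
      using ideal_add[OF N koszul_d_in[OF N nN] hd_N] by simp
  qed
  then show ?case
    using mM unfolding N_def by blast
qed

lemma koszul_cocycle_is_boundary:
  fixes a :: "'x::finite \<Rightarrow> 'a::comm_ring_1"
  assumes "ideal M" "regular_sequence M fs" "set fs \<subseteq> ideal_gen (range a)"
    and "\<And>\<sigma>. c \<sigma> \<in> M" "\<And>\<sigma>. length fs \<le> card \<sigma> \<Longrightarrow> c \<sigma> = 0" "\<And>\<sigma>. koszul_d a c \<sigma> = 0"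
  obtains e where "\<And>\<sigma>. e \<sigma> \<in> M" "\<And>\<sigma>. c \<sigma> = koszul_d a e \<sigma>"
  using koszul_cocycle_is_boundary_mod[OF assms(1-3), of 0 c] assms(4-) that
  by (auto simp: ideal_times_empty)


section \<open>Iterated exterior products\<close>

text \<open>
  The product $a_i\wedge\cdots\wedge a_1\wedge c$ in the exterior algebra.
\<close>

primrec wedge :: "(nat \<Rightarrow> 'x::finite \<Rightarrow> 'a::comm_ring_1) \<Rightarrow> ('x set \<Rightarrow> 'a) \<Rightarrow> nat \<Rightarrow> 'x set \<Rightarrow> 'a" where
  "wedge a c 0 = c"
| "wedge a c (Suc i) = koszul_d (a (Suc i)) (wedge a c i)"

lemma koszul_d_zero [simp]: "koszul_d a (\<lambda>_. 0) = (\<lambda>_. 0)"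
  by (simp add: koszul_d_def fun_eq_iff)

text \<open>
  The factor \<open>b\<close> moves, up to sign, past the other factors until it meets \<open>c\<close> or a copy of itself.
\<close>

lemma koszul_d_wedge_zero:
  assumes "koszul_d b c = (\<lambda>_. 0) \<or> (\<exists>j\<in>{1..i}. b = a j)"
  shows "koszul_d b (wedge a c i) = (\<lambda>_. 0)"
  using assms
proof (induction i)
  case (Suc i)
  show ?case
  proof (cases "b = a (Suc i)")
    case True
    then show ?thesis
      by (simp add: fun_eq_iff koszul_d_square)
  next
    case False
    then have "koszul_d b c = (\<lambda>_. 0) \<or> (\<exists>j\<in>{1..i}. b = a j)"
      using Suc.prems by (auto simp: le_Suc_eq)
    then have "koszul_d b (wedge a c i) = (\<lambda>_. 0)"
      by (rule Suc.IH)
    then show ?thesis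
      using koszul_d_anticommute[of b "a (Suc i)" "wedge a c i"] by (simp add: ext)
  qed
qed auto

lemma wedge_card:
  assumes "\<And>\<sigma>. card \<sigma> \<noteq> w \<Longrightarrow> c \<sigma> = 0" "card \<sigma> \<noteq> w + i"
  shows "wedge a c i \<sigma> = 0"
  using assms(2)
proof (induction i arbitrary: \<sigma>)
  case (Suc i)
  have "wedge a c i (\<sigma> - {k}) = 0" if "k \<in> \<sigma>" for k
    using Suc.prems that card_Suc_Diff1[of \<sigma> k] by (intro Suc.IH) auto
  then show ?case
    by (simp add: koszul_d_def)
qed (use assms(1) in simp)

lemma wedge_in:
  assumes "ideal J" "j \<in> {1..i}" "\<And>k. a j k \<in> J"
  shows "wedge a c i \<sigma> \<in> J"
  using assms(2)
proof (induction i arbitrary: \<sigma>)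
  case (Suc i)
  show ?case
  proof (cases "j = Suc i")
    case True
    have "wedge a c i (\<sigma> - {k}) * (koszul_sign k \<sigma> * a (Suc i) k) \<in> J" for k
      using assms(1,3) True by (intro ideal_mult) auto
    then show ?thesis
      using assms(1) by (auto simp: koszul_d_def mult_ac intro!: ideal_sum)
  next
    case False
    then show ?thesis
      using Suc by (auto intro!: koszul_d_in[OF assms(1)])
  qed
qed simp


section \<open>Spaces spanned by monomials and Stanley spaces\<close>

definition monomial_space :: "('x \<Rightarrow>\<^sub>0 nat) set \<Rightarrow> ('x, 'k::comm_ring_1) mpoly set" where
  "monomial_space E = {f. Poly_Mapping.keys f \<subseteq> E}"

lemma keys_sum_subset: "Poly_Mapping.keys (\<Sum>i\<in>T. f i) \<subseteq> (\<Union>i\<in>T. Poly_Mapping.keys (f i))"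
proof
  fix m assume "m \<in> Poly_Mapping.keys (\<Sum>i\<in>T. f i)"
  then have "(\<Sum>i\<in>T. Poly_Mapping.lookup (f i) m) \<noteq> 0"
    by (simp add: in_keys_iff lookup_sum)
  then show "m \<in> (\<Union>i\<in>T. Poly_Mapping.keys (f i))"
    by (metis (no_types, lifting) UN_I in_keys_iff sum.neutral)
qed

lemma poly_mapping_eq_sum_single:
  "f = (\<Sum>m\<in>Poly_Mapping.keys f. Poly_Mapping.single m (Poly_Mapping.lookup f m))"
  by (rule poly_mapping_eqI) (auto simp: lookup_sum lookup_single when_def in_keys_iff)

lemma monomial_space_Un:
  "monomial_space (E \<union> F) = (monomial_space E + monomial_space F :: ('x, 'k::comm_ring_1) mpoly set)"
proof
  show "monomial_space (E \<union> F) \<subseteq> (monomial_space E + monomial_space F :: ('x, 'k) mpoly set)"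
  proof
    fix f :: "('x, 'k) mpoly" assume f: "f \<in> monomial_space (E \<union> F)"
    define part where "part X = (\<Sum>m\<in>X. Poly_Mapping.single m (Poly_Mapping.lookup f m))" for X
    have "part X \<in> monomial_space X" for X
      using keys_sum_subset[of "\<lambda>m. Poly_Mapping.single m (Poly_Mapping.lookup f m)" X]
      by (auto simp: part_def monomial_space_def split: if_splits)
    then have "part (Poly_Mapping.keys f \<inter> E) \<in> monomial_space E"
      "part (Poly_Mapping.keys f - E) \<in> monomial_space F"
      using f by (fastforce simp: monomial_space_def)+
    moreover have "f = part (Poly_Mapping.keys f \<inter> E) + part (Poly_Mapping.keys f - E)"
      unfolding part_def
      by (subst sum.union_disjoint[symmetric])
        (auto simp: Int_Diff_Un intro!: poly_mapping_eq_sum_single)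
    ultimately show "f \<in> monomial_space E + monomial_space F"
      unfolding set_plus_def by blast
  qed
  show "(monomial_space E + monomial_space F :: ('x, 'k) mpoly set) \<subseteq> monomial_space (E \<union> F)"
  proof
    fix f :: "('x, 'k) mpoly" assume "f \<in> monomial_space E + monomial_space F"
    then obtain g h where "f = g + h" "g \<in> monomial_space E" "h \<in> monomial_space F"
      by (rule set_plus_elim)
    then show "f \<in> monomial_space (E \<union> F)"
      using keys_add[of g h] by (auto simp: monomial_space_def)
  qed
qed

lemma monomial_space_UN:
  assumes "finite T"
  shows "monomial_space (\<Union>i\<in>T. E i) = (\<Sum>i\<in>T. monomial_space (E i) :: ('x, 'k::comm_ring_1) mpoly set)"
  using assms
proof (induction T rule: finite_induct)
  case empty
  show ?case
    by (auto simp: monomial_space_def)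
next
  case (insert i T)
  then show ?case
    by (simp add: monomial_space_Un)
qed

lemma is_direct_sum_monomial_space:
  assumes "(\<Union>i<r. E i) = F" "\<And>i j. i < r \<Longrightarrow> j < r \<Longrightarrow> i \<noteq> j \<Longrightarrow> E i \<inter> E j = {}"
  shows "is_direct_sum (monomial_space F :: ('x, 'k::comm_ring_1) mpoly set) r (\<lambda>i. monomial_space (E i))"
  unfolding is_direct_sum_def
proof (intro conjI allI impI)
  show "(monomial_space F :: ('x, 'k) mpoly set) = (\<Sum>i<r. monomial_space (E i))"
    using monomial_space_UN[of "{..<r}" E] assms(1) by simp
  fix v :: "nat \<Rightarrow> ('x, 'k) mpoly" and i
  assume v: "(\<forall>i<r. v i \<in> monomial_space (E i)) \<and> (\<Sum>i<r. v i) = 0" and i: "i < r"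
  show "v i = 0"
  proof (rule ccontr)
    assume "v i \<noteq> 0"
    then obtain m where m: "Poly_Mapping.lookup (v i) m \<noteq> 0"
      by (metis lookup_zero poly_mapping_eqI)
    then have "m \<in> E i"
      using v i by (auto simp: monomial_space_def in_keys_iff subset_iff)
    have "Poly_Mapping.lookup (v j) m = 0" if "j < r" "j \<noteq> i" for j
    proof (rule ccontr)
      assume "Poly_Mapping.lookup (v j) m \<noteq> 0"
      then have "m \<in> E j"
        using v that by (auto simp: monomial_space_def in_keys_iff subset_iff)
      then show False
        using assms(2)[OF that(1) i that(2)] \<open>m \<in> E i\<close> by blast
    qed
    then have "(\<Sum>j<r. Poly_Mapping.lookup (v j) m) = (\<Sum>j\<in>{i}. Poly_Mapping.lookup (v j) m)"
      using i by (intro sum.mono_neutral_right) auto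
    then have "Poly_Mapping.lookup (v i) m = Poly_Mapping.lookup (\<Sum>j<r. v j) m"
      by (simp add: lookup_sum)
    then show False
      using v m by simp
  qed
qed

text \<open>
  The exponents of the monomials that lie in the ideal generated by the variables in \<open>A\<close>.
\<close>

definition hitting :: "'x set \<Rightarrow> ('x \<Rightarrow>\<^sub>0 nat) set" where
  "hitting A = {m. Poly_Mapping.keys m \<inter> A \<noteq> {}}"

lemma keys_add_nat: "Poly_Mapping.keys (u + v :: 'x \<Rightarrow>\<^sub>0 nat) = Poly_Mapping.keys u \<union> Poly_Mapping.keys v"
  by (auto simp: in_keys_iff lookup_add)

lemma ideal_gen_Var_image:
  "ideal_gen (Var ` A) = (monomial_space (hitting A) :: ('x, 'k::field) mpoly set)"
proof
  have "ideal (monomial_space (hitting A) :: ('x, 'k) mpoly set)"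
  proof (rule idealI)
    show "f + g \<in> monomial_space (hitting A)"
      if "f \<in> monomial_space (hitting A)" "g \<in> monomial_space (hitting A)" for f g :: "('x, 'k) mpoly"
      using that keys_add[of f g] by (auto simp: monomial_space_def)
    show "r * f \<in> monomial_space (hitting A)"
      if "f \<in> monomial_space (hitting A)" for r f :: "('x, 'k) mpoly"
    proof -
      have "a + b \<in> hitting A" if "b \<in> Poly_Mapping.keys f" for a b
        using that \<open>f \<in> _\<close> by (auto simp: monomial_space_def hitting_def keys_add_nat)
      then show ?thesis
        using keys_mult[of r f] by (auto simp: monomial_space_def)
    qed
  qed (simp add: monomial_space_def)
  moreover have "Var ` A \<subseteq> (monomial_space (hitting A) :: ('x, 'k) mpoly set)"
    by (auto simp: Var_def monomial_def monomial_space_def hitting_def)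
  ultimately show "ideal_gen (Var ` A) \<subseteq> (monomial_space (hitting A) :: ('x, 'k) mpoly set)"
    by (rule ideal_gen_minimal[rotated])
  show "(monomial_space (hitting A) :: ('x, 'k) mpoly set) \<subseteq> ideal_gen (Var ` A)"
  proof
    fix f :: "('x, 'k) mpoly" assume f: "f \<in> monomial_space (hitting A)"
    have "Poly_Mapping.single m (Poly_Mapping.lookup f m) \<in> ideal_gen (Var ` A)" if m: "m \<in> Poly_Mapping.keys f" for m
    proof -
      obtain x where x: "x \<in> A" "x \<in> Poly_Mapping.keys m"
        using f m by (auto simp: monomial_space_def hitting_def)
      have "m = (m - Poly_Mapping.single x 1) + Poly_Mapping.single x 1"
        using x(2) by (intro poly_mapping_eqI)
          (auto simp: lookup_add lookup_minus lookup_single when_def in_keys_iff)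
      then have "Poly_Mapping.single m (Poly_Mapping.lookup f m) =
          Poly_Mapping.single (m - Poly_Mapping.single x 1) (Poly_Mapping.lookup f m) * Var x"
        unfolding Var_def monomial_def mult_single by simp
      then show ?thesis
        using ideal_mult[OF ideal_ideal_gen ideal_gen_base] x(1) by (metis imageI)
    qed
    then show "f \<in> ideal_gen (Var ` A)"
      by (subst poly_mapping_eq_sum_single) (rule ideal_sum[OF ideal_ideal_gen])
  qed
qed

definition squarefree_exponent :: "'x set \<Rightarrow> 'x \<Rightarrow>\<^sub>0 nat" where
  "squarefree_exponent C = (\<Sum>x\<in>C. Poly_Mapping.single x 1)"

lemma lookup_squarefree_exponent:
  "Poly_Mapping.lookup (squarefree_exponent (C :: 'x::finite set)) x = (if x \<in> C then 1 else 0)"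
  by (simp add: squarefree_exponent_def lookup_sum lookup_single when_def)

lemma keys_squarefree_exponent: "Poly_Mapping.keys (squarefree_exponent (C :: 'x::finite set)) = C"
  by (auto simp: in_keys_iff lookup_squarefree_exponent split: if_splits)

lemma stanley_space_eq_monomial_space:
  "stanley_space u Z = (monomial_space {u + v |v. Poly_Mapping.keys v \<subseteq> Z} :: ('x, 'k::field) mpoly set)"
proof
  let ?E = "{u + v |v. Poly_Mapping.keys v \<subseteq> Z}"
  have "module.subspace kscale (monomial_space ?E :: ('x, 'k) mpoly set)"
  proof (rule module.subspaceI[OF module_kscale])
    show "f + g \<in> monomial_space ?E"
      if "f \<in> monomial_space ?E" "g \<in> monomial_space ?E" for f g :: "('x, 'k) mpoly"
      using that keys_add[of f g] unfolding monomial_space_def by blast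
    show "kscale c f \<in> monomial_space ?E" if "f \<in> monomial_space ?E" for c and f :: "('x, 'k) mpoly"
      using that keys_mult[of "Poly_Mapping.single 0 c" f]
      unfolding monomial_space_def kscale_def by (auto split: if_splits)
  qed (simp add: monomial_space_def)
  moreover have "(\<lambda>f. monomial u * f) ` polys_in Z \<subseteq> (monomial_space ?E :: ('x, 'k) mpoly set)"
  proof safe
    fix f :: "('x, 'k) mpoly" assume "f \<in> polys_in Z"
    then show "monomial u * f \<in> monomial_space ?E"
      using keys_mult[of "monomial u" f]
      by (fastforce simp: monomial_space_def polys_in_def monomial_def)
  qed
  ultimately show "stanley_space u Z \<subseteq> (monomial_space ?E :: ('x, 'k) mpoly set)"
    unfolding stanley_space_def by (rule module.span_minimal[OF module_kscale, rotated])
  show "(monomial_space ?E :: ('x, 'k) mpoly set) \<subseteq> stanley_space u Z"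
  proof
    fix f :: "('x, 'k) mpoly" assume f: "f \<in> monomial_space ?E"
    have "Poly_Mapping.single m (Poly_Mapping.lookup f m) \<in> stanley_space u Z" if m: "m \<in> Poly_Mapping.keys f" for m
    proof -
      obtain v where v: "m = u + v" "Poly_Mapping.keys v \<subseteq> Z"
        using f m by (auto simp: monomial_space_def)
      have "Poly_Mapping.single m (Poly_Mapping.lookup f m) = monomial u * Poly_Mapping.single v (Poly_Mapping.lookup f m)"
        by (simp add: v monomial_def mult_single)
      moreover have "Poly_Mapping.single v (Poly_Mapping.lookup f m) \<in> polys_in Z"
        using v by (simp add: polys_in_def)
      ultimately show ?thesis
        unfolding stanley_space_def by (intro module.span_base[OF module_kscale]) auto
    qed
    then show "f \<in> stanley_space u Z"
      unfolding stanley_space_def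
      by (subst poly_mapping_eq_sum_single) (rule module.span_sum[OF module_kscale])
  qed
qed

text \<open>
  An interval of supports corresponds to one Stanley space. This turns the search for a Stanley
  decomposition of a squarefree monomial ideal into that for a partition of its supports into
  intervals.
\<close>

lemma squarefree_cone:
  fixes C Z :: "'x::finite set"
  assumes "C \<subseteq> Z"
  shows "{squarefree_exponent C + v |v. Poly_Mapping.keys v \<subseteq> Z} =
    {m. C \<subseteq> Poly_Mapping.keys m \<and> Poly_Mapping.keys m \<subseteq> Z}"
proof safe
  fix m :: "'x \<Rightarrow>\<^sub>0 nat" assume m: "C \<subseteq> Poly_Mapping.keys m" "Poly_Mapping.keys m \<subseteq> Z"
  define v where "v = m - squarefree_exponent C"
  have "m = squarefree_exponent C + v"
    using m(1) by (intro poly_mapping_eqI)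
      (auto simp: v_def lookup_add lookup_minus lookup_squarefree_exponent in_keys_iff subset_iff
        Suc_le_eq)
  moreover have "Poly_Mapping.keys v \<subseteq> Z"
    using m(2) by (auto simp: v_def in_keys_iff lookup_minus subset_iff)
  ultimately show "\<exists>v. m = squarefree_exponent C + v \<and> Poly_Mapping.keys v \<subseteq> Z"
    by blast
qed (use assms in \<open>auto simp: keys_add_nat keys_squarefree_exponent\<close>)

lemma Var_mult_squarefree_monomial:
  fixes C :: "'x::finite set"
  assumes "x \<notin> C"
  shows "Var x * monomial (squarefree_exponent C) =
    (monomial (squarefree_exponent (insert x C)) :: ('x, 'k::comm_ring_1) mpoly)"
  using assms by (simp add: Var_def monomial_def mult_single squarefree_exponent_def)

text \<open>
  The maximum in the definition of the Stanley depth ranges over finitely many values: every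
  nonempty decomposition has a value of at most the number of variables, and the empty one
  contributes the single value \<^term>\<open>Min {} :: nat\<close>.
\<close>

lemma sdepth_decomposition_le_sdepth:
  assumes "stanley_decomposition I D"
  shows "sdepth_decomposition D \<le> sdepth I"
proof -
  have "sdepth_decomposition D' \<in> insert (Min {}) {..card (UNIV :: 'a set)}"
    for D' :: "(('a \<Rightarrow>\<^sub>0 nat) \<times> 'a set) list"
  proof (cases "D' = []")
    case True
    then show ?thesis
      by (simp add: sdepth_decomposition_def)
  next
    case False
    have "{card Z |u Z. (u, Z) \<in> set D'} = (\<lambda>(u, Z). card Z) ` set D'"
      by force
    then have "Min {card Z |u Z. (u, Z) \<in> set D'} \<in> (\<lambda>(u, Z). card Z) ` set D'"
      using False by (simp only:) (intro Min_in, auto)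
    then show ?thesis
      by (auto simp: sdepth_decomposition_def intro!: card_mono)
  qed
  then have "{sdepth_decomposition D |D. stanley_decomposition I D} \<subseteq>
      insert (Min {}) {..card (UNIV :: 'a set)}"
    by blast
  then have "finite {sdepth_decomposition D |D. stanley_decomposition I D}"
    by (rule finite_subset) simp
  then show ?thesis
    unfolding sdepth_def using assms by (intro Max_ge) auto
qed


section \<open>Sets of variables with private elements\<close>

text \<open>
  The combinatorial content of the hypothesis on the primes: \<open>p i\<close> lies in \<open>A i\<close> and in no other
  of these sets.
\<close>

locale private_variables =
  fixes A :: "nat \<Rightarrow> 'x::finite set" and s :: nat and p :: "nat \<Rightarrow> 'x"
  assumes p_in: "i \<in> {1..s} \<Longrightarrow> p i \<in> A i"
    and p_private: "i \<in> {1..s} \<Longrightarrow> j \<in> {1..s} \<Longrightarrow> p j \<in> A i \<Longrightarrow> j = i"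
begin

definition uncovered :: "'x set" where
  "uncovered = - (\<Union>i\<in>{1..s}. A i)"

text \<open>
  The exponents of the monomials in the intersection $I$ of the primes.
\<close>

definition hitting_all :: "('x \<Rightarrow>\<^sub>0 nat) set" where
  "hitting_all = (\<Inter>i\<in>{1..s}. hitting (A i))"

lemma inj_on_p: "inj_on p {1..s}"
  using p_in p_private by (metis inj_onI)

lemma p_not_free: "i \<in> {1..s} \<Longrightarrow> p i \<notin> uncovered"
  using p_in unfolding uncovered_def by blast

lemma monomial_space_hitting_all:
  "monomial_space hitting_all = (\<Inter>i\<in>{1..s}. monomial_space (hitting (A i)))"
  unfolding monomial_space_def hitting_all_def by blast

subsection \<open>The upper bound for the depth\<close>

text \<open>
  The fibres of this function over $1,\ldots,s$ are the blocks $B_i$; the variables in none of the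
  \<open>A i\<close> are the fibre over 0.
\<close>

definition owner :: "'x \<Rightarrow> nat" where
  "owner x = (if x \<in> uncovered then 0 else SOME i. i \<in> {1..s} \<and> x \<in> A i)"

lemma owner_cases: "owner x = 0 \<and> x \<in> uncovered \<or> owner x \<in> {1..s} \<and> x \<in> A (owner x)"
proof (cases "x \<in> uncovered")
  case False
  then have "\<exists>i. i \<in> {1..s} \<and> x \<in> A i"
    by (auto simp: uncovered_def)
  from someI_ex[OF this] show ?thesis
    using False by (simp add: owner_def)
qed (simp add: owner_def)

lemma owner_p: "i \<in> {1..s} \<Longrightarrow> owner (p i) = i"
  using owner_cases[of "p i"] p_private[of "owner (p i)" i] p_not_free[of i] by auto

definition block_weight :: "nat \<Rightarrow> 'x \<Rightarrow> ('x, 'k::field) mpoly" where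
  "block_weight i x = (if owner x = i then Var x else 0)"

text \<open>
  The product $w_i\wedge\cdots\wedge w_1\wedge\varepsilon$, where $\varepsilon$ is represented by the
  indicator function of the set of uncovered variables. For $i = s$ it is the desired cocycle.
\<close>

definition cocycle_upto :: "nat \<Rightarrow> 'x set \<Rightarrow> ('x, 'k::field) mpoly" where
  "cocycle_upto = wedge block_weight (\<lambda>\<sigma>. if \<sigma> = uncovered then 1 else 0)"

text \<open>
  The weights of the blocks add up to \<^const>\<open>Var\<close>. The block 0 kills $\varepsilon$, because its
  variables already occur in $\varepsilon$, and each other block occurs twice in the product.
\<close>

lemma koszul_d_cocycle: "koszul_d Var (cocycle_upto s) = (\<lambda>_. 0 :: ('x, 'k::field) mpoly)"
proof -
  have "Var x = (\<Sum>i\<le>s. block_weight i x :: ('x, 'k) mpoly)" for x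
    using owner_cases[of x] by (auto simp: block_weight_def)
  then have Var_eq: "Var = (\<lambda>x. \<Sum>i\<le>s. block_weight i x :: ('x, 'k) mpoly)"
    by blast
  have "koszul_d (block_weight 0) (\<lambda>\<sigma>. if \<sigma> = uncovered then 1 else 0) = (\<lambda>_. 0 :: ('x, 'k) mpoly)"
    using owner_cases by (fastforce simp: koszul_d_def block_weight_def intro!: sum.neutral)
  then have "koszul_d (block_weight i) (cocycle_upto s) = (\<lambda>_. 0 :: ('x, 'k) mpoly)" if "i \<le> s" for i
    unfolding cocycle_upto_def using that by (cases "i = 0") (auto intro!: koszul_d_wedge_zero)
  then show ?thesis
    by (simp add: Var_eq koszul_d_sum_weight fun_eq_iff)
qed

text \<open>
  The factor $w_i$ has its coefficients in $P_i$, because its block is contained in \<open>A i\<close>.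
\<close>

lemma cocycle_in:
  "cocycle_upto s \<sigma> \<in> (\<Inter>i\<in>{1..s}. ideal_gen (Var ` A i) :: ('x, 'k::field) mpoly set)"
proof
  fix i assume i: "i \<in> {1..s}"
  have "block_weight i x \<in> (ideal_gen (Var ` A i) :: ('x, 'k) mpoly set)" for x
    using i owner_cases[of x] ideal_zero[OF ideal_ideal_gen]
    by (cases "owner x = i") (auto simp: block_weight_def intro: ideal_gen_base)
  then show "cocycle_upto s \<sigma> \<in> (ideal_gen (Var ` A i) :: ('x, 'k) mpoly set)"
    unfolding cocycle_upto_def using i by (intro wedge_in[OF ideal_ideal_gen])
qed

text \<open>
  Among the variables in this set, the factor $w_j$ involves only \<open>p j\<close>, since private variables
  belong to the blocks of their own sets. So a single term contributes to the coefficient.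
\<close>

lemma cocycle_at_private:
  assumes "i \<le> s"
  shows "cocycle_upto i (uncovered \<union> p ` {1..i}) \<in>
    {monomial (squarefree_exponent (p ` {1..i})), - monomial (squarefree_exponent (p ` {1..i})) :: ('x, 'k::field) mpoly}"
  using assms
proof (induction i)
  case 0
  show ?case
    by (simp add: cocycle_upto_def squarefree_exponent_def monomial_def)
next
  case (Suc i)
  define \<sigma> where "\<sigma> = uncovered \<union> p ` {1..Suc i}"
  define C where "C = p ` {1..i}"
  have new: "p (Suc i) \<notin> C"
  proof
    assume "p (Suc i) \<in> C"
    then obtain j where "j \<in> {1..i}" "p (Suc i) = p j"
      by (auto simp: C_def)
    then show False
      using inj_onD[OF inj_on_p, of "Suc i" j] Suc.prems by auto
  qed
  have new_free: "p (Suc i) \<notin> uncovered"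
    using p_not_free[of "Suc i"] Suc.prems by simp
  have C_Suc: "p ` {1..Suc i} = insert (p (Suc i)) C"
    by (auto simp: C_def atLeastAtMostSuc_conv)
  then have \<sigma>: "p (Suc i) \<in> \<sigma>" "\<sigma> - {p (Suc i)} = uncovered \<union> C"
    using new new_free by (auto simp: \<sigma>_def)
  \<comment> \<open>In \<open>\<sigma>\<close>, only \<open>p (Suc i)\<close> belongs to the block that the last factor sums over.\<close>
  have "block_weight (Suc i) k = (0 :: ('x, 'k) mpoly)" if "k \<in> \<sigma> - {p (Suc i)}" for k
  proof -
    have "k \<in> uncovered \<or> (\<exists>j\<in>{1..i}. k = p j)"
      using that unfolding \<sigma>(2) C_def by blast
    then have "owner k \<noteq> Suc i"
    proof
      assume "\<exists>j\<in>{1..i}. k = p j"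
      then obtain j where "j \<in> {1..i}" "k = p j"
        by blast
      then show ?thesis
        using owner_p[of j] Suc.prems by simp
    qed (simp add: owner_def)
    then show ?thesis
      by (simp add: block_weight_def)
  qed
  then have "cocycle_upto (Suc i) \<sigma> = (\<Sum>k\<in>{p (Suc i)}. koszul_sign k \<sigma> * block_weight (Suc i) k *
      cocycle_upto i (\<sigma> - {k}) :: ('x, 'k) mpoly)"
    unfolding cocycle_upto_def wedge.simps koszul_d_def
    using \<sigma>(1) by (intro sum.mono_neutral_right) auto
  also have "\<dots> = koszul_sign (p (Suc i)) \<sigma> * (Var (p (Suc i)) * cocycle_upto i (uncovered \<union> C))"
    using owner_p[of "Suc i"] Suc.prems by (simp add: \<sigma> block_weight_def mult.assoc)
  finally have "cocycle_upto (Suc i) \<sigma> =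
    (koszul_sign (p (Suc i)) \<sigma> * (Var (p (Suc i)) * cocycle_upto i (uncovered \<union> C)) :: ('x, 'k) mpoly)" .
  moreover have "cocycle_upto i (uncovered \<union> C) \<in>
      {monomial (squarefree_exponent C), - monomial (squarefree_exponent C) :: ('x, 'k) mpoly}"
    using Suc by (simp add: C_def)
  ultimately show ?case
    unfolding \<sigma>_def[symmetric]
    unfolding C_Suc Var_mult_squarefree_monomial[OF new, symmetric]
    using koszul_sign_cases[of "p (Suc i)" \<sigma>, where 'a = "('x, 'k) mpoly"] by auto
qed

text \<open>
  If the monomial $p_1\cdots p_s$ were \<open>x\<close> times a monomial $v$ of $I$, then $x = p_i$ for some $i$,
  and $v$ would contain no element of \<open>A i\<close>, since $p_i$ is the only private variable
  in \<open>A i\<close>.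
\<close>

lemma private_monomial_not_in_max_ideal_times:
  fixes g :: "('x, 'k::field) mpoly"
  assumes "g \<in> monomial_space hitting_all"
  shows "Poly_Mapping.lookup (Var x * g) (squarefree_exponent (p ` {1..s})) = 0"
proof (rule ccontr)
  assume "Poly_Mapping.lookup (Var x * g) (squarefree_exponent (p ` {1..s})) \<noteq> 0"
  then have "squarefree_exponent (p ` {1..s}) \<in> Poly_Mapping.keys (Var x * g)"
    by (simp add: in_keys_iff)
  then obtain v where v: "v \<in> Poly_Mapping.keys g"
    and eq: "squarefree_exponent (p ` {1..s}) = Poly_Mapping.single x 1 + v"
    using keys_mult[of "Var x" g] by (auto simp: Var_def monomial_def)
  have lookup_eq: "(if y \<in> p ` {1..s} then 1 else 0) = (if x = y then 1 else 0) + Poly_Mapping.lookup v y" for y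
    using arg_cong[OF eq, of "\<lambda>m. Poly_Mapping.lookup m y"]
    by (simp add: lookup_squarefree_exponent lookup_add lookup_single when_def)
  have "x \<in> p ` {1..s}"
    using lookup_eq[of x] by (simp split: if_splits)
  then obtain i where i: "i \<in> {1..s}" "x = p i"
    by blast
  have "v \<in> hitting (A i)"
    using assms v i(1) unfolding monomial_space_def hitting_all_def by blast
  then obtain y where y: "y \<in> A i" "Poly_Mapping.lookup v y \<noteq> 0"
    by (auto simp: hitting_def in_keys_iff)
  have "y \<in> p ` {1..s}"
  proof (rule ccontr)
    assume "y \<notin> p ` {1..s}"
    then show False
      using lookup_eq[of y] y(2) by simp
  qed
  then obtain j where "j \<in> {1..s}" "y = p j"
    by blast
  then have "y = x"
    using p_private[OF i(1)] y(1) i(2) by blast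
  then show False
    using lookup_eq[of x] y(2) by (auto split: if_splits)
qed

text \<open>
  The cocycle is concentrated in degree \<open>card uncovered + s\<close>, so a longer regular sequence would make
  it a coboundary.
\<close>

theorem depth_le: "depth (monomial_space hitting_all :: ('x, 'k::field) mpoly set) \<le> enat (card uncovered + s)"
  unfolding depth_def
proof (rule Sup_least, safe)
  let ?I = "monomial_space hitting_all :: ('x, 'k) mpoly set"
  let ?u = "squarefree_exponent (p ` {1..s})"
  fix fs :: "('x, 'k) mpoly list"
  assume fs: "set fs \<subseteq> max_ideal" and reg: "regular_sequence ?I fs"
  have I_eq: "?I = (\<Inter>i\<in>{1..s}. ideal_gen (Var ` A i))"
    by (simp add: monomial_space_hitting_all ideal_gen_Var_image)
  have I: "ideal ?I"
    unfolding I_eq by (rule idealI) (auto intro: ideal_zero ideal_add ideal_mult ideal_ideal_gen)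
  show "enat (length fs) \<le> enat (card uncovered + s)"
  proof (rule ccontr)
    assume long: "\<not> enat (length fs) \<le> enat (card uncovered + s)"
    have vanish: "cocycle_upto s \<sigma> = (0 :: ('x, 'k) mpoly)" if "length fs \<le> card \<sigma>" for \<sigma>
      unfolding cocycle_upto_def using that long by (intro wedge_card[where w = "card uncovered"]) auto
    obtain e where e: "\<And>\<sigma>. e \<sigma> \<in> ?I" and bd: "\<And>\<sigma>. cocycle_upto s \<sigma> = koszul_d Var e \<sigma>"
    proof (rule koszul_cocycle_is_boundary[OF I reg fs[unfolded max_ideal_def]])
      show "cocycle_upto s \<sigma> \<in> ?I" for \<sigma>
        unfolding I_eq by (rule cocycle_in)
      show "koszul_d Var (cocycle_upto s) \<sigma> = (0 :: ('x, 'k) mpoly)" for \<sigma>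
        by (simp add: koszul_d_cocycle)
      show "cocycle_upto s \<sigma> = (0 :: ('x, 'k) mpoly)" if "length fs \<le> card \<sigma>" for \<sigma>
        using that by (rule vanish)
    qed (rule that)
    let ?\<sigma> = "uncovered \<union> p ` {1..s}"
    have "Poly_Mapping.lookup (koszul_d Var e ?\<sigma>) ?u = 0"
      unfolding koszul_d_def lookup_sum
    proof (rule sum.neutral, rule ballI)
      fix k
      have "koszul_sign k ?\<sigma> * e (?\<sigma> - {k}) \<in> ?I"
        using e by (intro ideal_mult[OF I])
      then show "Poly_Mapping.lookup (koszul_sign k ?\<sigma> * Var k * e (?\<sigma> - {k})) ?u = 0"
        using private_monomial_not_in_max_ideal_times[of "koszul_sign k ?\<sigma> * e (?\<sigma> - {k})" k]
        by (simp add: mult_ac)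
    qed
    then show False
      using cocycle_at_private[of s, where 'k = 'k] by (auto simp: bd monomial_def)
  qed
qed

subsection \<open>The lower bound for the Stanley depth\<close>

text \<open>
  The supports of the monomials in $I$ that agree outside the private and the uncovered variables
  form an interval of sets. Its least element adds to \<open>\<tau>\<close> the private variables that are needed to
  meet the sets \<open>A i\<close> that \<open>\<tau>\<close> misses; its greatest element adds all private and uncovered variables.
\<close>

definition interval_bottom :: "'x set \<Rightarrow> 'x set" where
  "interval_bottom \<tau> = \<tau> \<union> p ` {i\<in>{1..s}. A i \<inter> \<tau> = {}}"

definition interval_top :: "'x set \<Rightarrow> 'x set" where
  "interval_top \<tau> = \<tau> \<union> p ` {1..s} \<union> uncovered"

text \<open>
  If \<open>\<tau>\<close> misses \<open>A i\<close>, then \<open>p i\<close> is the only element of \<open>A i\<close> that a support over \<open>\<tau>\<close> can still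
  contain. For given \<open>\<rho>\<close> the right-hand side determines \<open>\<tau>\<close>, so the intervals partition the
  supports of the monomials in $I$.
\<close>

lemma in_interval_iff:
  assumes "\<tau> \<subseteq> - (p ` {1..s} \<union> uncovered)"
  shows "interval_bottom \<tau> \<subseteq> \<rho> \<and> \<rho> \<subseteq> interval_top \<tau> \<longleftrightarrow>
    \<tau> = \<rho> - (p ` {1..s} \<union> uncovered) \<and> (\<forall>i\<in>{1..s}. \<rho> \<inter> A i \<noteq> {})"
proof safe
  fix x assume "interval_bottom \<tau> \<subseteq> \<rho>" "x \<in> \<tau>"
  then show "x \<in> \<rho>"
    by (auto simp: interval_bottom_def)
next
  fix i assume bot: "interval_bottom \<tau> \<subseteq> \<rho>" and i: "i \<in> {1..s}" and "\<rho> \<inter> A i = {}"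
  then have "A i \<inter> \<tau> = {}"
    by (auto simp: interval_bottom_def)
  then have "p i \<in> \<rho> \<inter> A i"
    using bot i p_in[OF i] by (auto simp: interval_bottom_def)
  then show False
    using \<open>\<rho> \<inter> A i = {}\<close> by blast
next
  fix x assume hit: "\<forall>i\<in>{1..s}. \<rho> \<inter> A i \<noteq> {}" and "\<tau> = \<rho> - (p ` {1..s} \<union> uncovered)"
    "x \<in> interval_bottom (\<rho> - (p ` {1..s} \<union> uncovered))"
  show "x \<in> \<rho>"
  proof (cases "x \<in> \<tau>")
    case False
    then obtain i where i: "i \<in> {1..s}" "x = p i" "A i \<inter> \<tau> = {}"
      using \<open>x \<in> _\<close> \<open>\<tau> = _\<close> by (auto simp: interval_bottom_def)
    obtain y where y: "y \<in> \<rho>" "y \<in> A i"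
      using hit i(1) by blast
    moreover have "y \<notin> uncovered"
      using y(2) i(1) by (auto simp: uncovered_def)
    ultimately obtain j where "j \<in> {1..s}" "y = p j"
      using i(3) \<open>\<tau> = _\<close> by blast
    then show ?thesis
      using p_private[OF i(1), of j] y i(2) by auto
  qed (use \<open>\<tau> = _\<close> in auto)
qed (use assms in \<open>auto simp: interval_top_def\<close>)

theorem sdepth_ge: "card uncovered + s \<le> sdepth (monomial_space hitting_all :: ('x, 'k::field) mpoly set)"
proof -
  let ?I = "monomial_space hitting_all :: ('x, 'k) mpoly set"
  define R where "R = - (p ` {1..s} \<union> uncovered)"
  obtain xs where xs: "set xs = Pow R" "distinct xs"
    using finite_distinct_list[of "Pow R"] by auto
  define D where "D = map (\<lambda>\<tau>. (squarefree_exponent (interval_bottom \<tau>), interval_top \<tau>)) xs"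
  define E where "E i = {fst (D ! i) + v |v. Poly_Mapping.keys v \<subseteq> snd (D ! i)}" for i
  have in_cone: "m \<in> {squarefree_exponent (interval_bottom \<tau>) + v |v. Poly_Mapping.keys v \<subseteq> interval_top \<tau>}
      \<longleftrightarrow> \<tau> = Poly_Mapping.keys m \<inter> R \<and> m \<in> hitting_all" if "\<tau> \<subseteq> R" for \<tau> m
  proof -
    have "interval_bottom \<tau> \<subseteq> interval_top \<tau>"
      by (auto simp: interval_bottom_def interval_top_def)
    then show ?thesis
      using in_interval_iff[of \<tau> "Poly_Mapping.keys m"] that
      by (simp add: squarefree_cone R_def Diff_eq hitting_all_def hitting_def)
  qed
  have E: "m \<in> E i \<longleftrightarrow> xs ! i = Poly_Mapping.keys m \<inter> R \<and> m \<in> hitting_all" if "i < length xs" for i m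
    using in_cone[of "xs ! i" m] that nth_mem[OF that] xs(1) by (simp add: E_def D_def)
  have cover: "(\<Union>i<length D. E i) = hitting_all"
  proof safe
    fix m assume m: "m \<in> hitting_all"
    have "Poly_Mapping.keys m \<inter> R \<in> set xs"
      by (simp add: xs)
    then obtain i where "i < length xs" "xs ! i = Poly_Mapping.keys m \<inter> R"
      by (metis in_set_conv_nth)
    then show "m \<in> (\<Union>i<length D. E i)"
      using m E by (auto simp: D_def)
  qed (simp add: E D_def)
  have "stanley_decomposition ?I D"
    unfolding stanley_decomposition_def
  proof (intro conjI ballI)
    have "E i \<inter> E j = {}" if ij: "i < length D" "j < length D" "i \<noteq> j" for i j
    proof (rule ccontr)
      assume "E i \<inter> E j \<noteq> {}"
      then have "xs ! i = xs ! j"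
        using ij E by (auto simp: D_def)
      then show False
        using ij nth_eq_iff_index_eq[OF xs(2), of i j] by (simp add: D_def)
    qed
    then show "is_direct_sum ?I (length D) (\<lambda>i. stanley_space (fst (D ! i)) (snd (D ! i)))"
      unfolding stanley_space_eq_monomial_space using is_direct_sum_monomial_space[OF cover]
      by (simp add: E_def)
  next
    fix d assume "d \<in> set D"
    then obtain i where i: "i < length D" "d = D ! i"
      by (metis in_set_conv_nth)
    then have E_sub: "E i \<subseteq> hitting_all"
      using cover by blast
    moreover have "fst d \<in> E i"
      by (auto simp: E_def i(2) intro!: exI[of _ 0])
    moreover have "stanley_space (fst d) (snd d) = (monomial_space (E i) :: ('x, 'k) mpoly set)"
      by (simp add: stanley_space_eq_monomial_space E_def i(2))
    ultimately show "case d of (u, Z) \<Rightarrow> monomial u \<in> ?I \<and> stanley_space u Z \<subseteq> ?I"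
      by (auto simp: split_beta monomial_space_def monomial_def)
  qed
  then have "sdepth_decomposition D \<le> sdepth ?I"
    by (rule sdepth_decomposition_le_sdepth)
  moreover have "card uncovered + s \<le> sdepth_decomposition D"
  proof -
    have "card (interval_top \<tau>) \<ge> card uncovered + s" for \<tau>
    proof -
      have "card uncovered + s = card (uncovered \<union> p ` {1..s})"
        using p_not_free by (subst card_Un_disjoint) (auto simp: card_image[OF inj_on_p, simplified])
      also have "\<dots> \<le> card (interval_top \<tau>)"
        by (rule card_mono) (auto simp: interval_top_def)
      finally show ?thesis .
    qed
    moreover have "{card Z |u Z. (u, Z) \<in> set D} = (\<lambda>\<tau>. card (interval_top \<tau>)) ` Pow R"
      by (auto simp: D_def xs(1))
    ultimately show ?thesis
      unfolding sdepth_decomposition_def by (simp only:) (intro Min.boundedI, auto)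
  qed
  ultimately show ?thesis
    by linarith
qed

end


section \<open>Intersections of monomial primes\<close>

theorem theorem2p4:
  fixes P :: "nat \<Rightarrow> ('x::finite, 'k::field) mpoly set"
    and I :: "('x, 'k) mpoly set"
    and s :: nat
  assumes "\<forall>i\<in>{1..s}. monomial_prime_ideal (P i)"
    and "I = (\<Inter>i\<in>{1..s}. P i)"
    and "irredundant_intersection {1..s} P"
    and "\<forall>i\<in>{1..s}. \<not> P i \<subseteq> (\<Sum>j\<in>{1..s} - {i}. P j)"
  shows "enat (sdepth I) \<ge> depth I"
proof -
  obtain A where "\<forall>i\<in>{1..s}. P i = ideal_gen (Var ` A i)"
    using assms(1) unfolding monomial_prime_ideal_def by metis
  then have P: "P i = monomial_space (hitting (A i))" if "i \<in> {1..s}" for i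
    using that by (simp add: ideal_gen_Var_image)
  have "\<exists>x. x \<in> A i \<and> (\<forall>j\<in>{1..s} - {i}. x \<notin> A j)" if i: "i \<in> {1..s}" for i
  proof (rule ccontr)
    assume "\<not> ?thesis"
    \<comment> \<open>A monomial of $P_i$ then lies in some other $P_j$, so $P_i$ is contained in their sum.\<close>
    then have "hitting (A i) \<subseteq> (\<Union>j\<in>{1..s} - {i}. hitting (A j))"
      by (auto simp: hitting_def)
    then have "P i \<subseteq> monomial_space (\<Union>j\<in>{1..s} - {i}. hitting (A j))"
      using i by (auto simp: P monomial_space_def)
    also have "\<dots> = (\<Sum>j\<in>{1..s} - {i}. P j)"
      by (subst monomial_space_UN) (auto simp: P intro!: sum.cong)
    finally show False
      using assms(4) i by blast
  qed
  then obtain p where p: "\<And>i. i \<in> {1..s} \<Longrightarrow> p i \<in> A i \<and> (\<forall>j\<in>{1..s} - {i}. p i \<notin> A j)"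
    by metis
  interpret private_variables A s p
    using p by unfold_locales blast+
  have "I = monomial_space hitting_all"
    using assms(2) P by (simp add: monomial_space_hitting_all)
  then have "depth I \<le> enat (card uncovered + s)" "card uncovered + s \<le> sdepth I"
    using depth_le sdepth_ge by auto
  then show ?thesis
    by (meson enat_ord_simps(1) order_trans)
qed

end
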